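(* Let $0<\lambda<n$. Then the operator $M^2$ is bounded from $\mathcal{M}_{L(1+\log^+L),\lambda}$ to $W\mathcal{M}_{L(1+\log^+L),\lambda}$, and the inequality $$\|M^2f\|_{W\mathcal{M}_{L(1+\log^+L),\lambda}}\le c\,\|f\|_{\mathcal{M}_{L(1+\log^+L),\lambda}}$$ holds with a positive constant $c$ independent of $f$.
   Context: Cubes in $\mathbb{R}^n$ have sides parallel to the coordinate axes; $\log^+t=\max\{\log t,0\}$. $M$ is the Hardy-Littlewood maximal operator $Mf(x)=\sup_{Q\ni x}\frac1{|Q|}\int_Q|f(y)|\,dy$ (supremum over all cubes $Q$ containing $x$), and $M^2f=M(Mf)$. For a cube $Q$ and measurable $g$: $\|g\|_{L(1+\log^+L),Q}:=\inf\{\alpha>0:\frac1{|Q|}\int_Q\frac{|g(x)|}{\alpha}\left(1+\log^+\frac{|g(x)|}{\alpha}\right)dx\le1\}$, $\|g\|_{WL(1+\log^+L),Q}:=\inf\left\{\alpha>0:\sup_{t>0}\frac1{|Q|}\frac{|\{x\in Q:|g(x)|>\alpha t\}|}{\frac1t\left(1+\log^+\frac1t\right)}\le1\right\}$. For $0<\lambda<n$, the Zygmund-Morrey space $\mathcal{M}_{L(1+\log^+L),\lambda}$ (also written $\mathcal M_{L(\log L),\lambda}$) and the weak Zygmund-Morrey space $W\mathcal{M}_{L(1+\log^+L),\lambda}$ consist of the measurable functions $f$ on $\mathbb{R}^n$ for which, respectively, $\|f\|_{\mathcal{M}_{L(1+\log^+L),\lambda}}:=\sup_Q|Q|^{\lambda/n}\|f\|_{L(1+\log^+L),Q}<\infty$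 and $\|f\|_{W\mathcal{M}_{L(1+\log^+L),\lambda}}:=\sup_Q|Q|^{\lambda/n}\|f\|_{WL(1+\log^+L),Q}<\infty$ (suprema over all cubes $Q$). *)

theory Defs
  imports "HOL-Analysis.Analysis"
begin

text \<open>
  Functions take values in the extended reals, since maximal functions may be infinite; norms take
  values in \<^typ>\<open>ennreal\<close>. An infimum over no admissible \<open>\<alpha>\<close> is \<open>\<infinity>\<close>.
\<close>

definition cubes :: "(real ^ 'n::finite) set set" where
  "cubes = {cbox a (a + (\<chi> i. l)) | a l. 0 < l}"

definition hl_maximal :: "(real ^ 'n::finite \<Rightarrow> ereal) \<Rightarrow> real ^ 'n \<Rightarrow> ereal" where
  "hl_maximal f x =
     enn2ereal (SUP Q\<in>{Q \<in> cubes. x \<in> Q}.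
       1 / emeasure lebesgue Q * (\<integral>\<^sup>+y\<in>Q. e2ennreal \<bar>f y\<bar> \<partial>lebesgue))"

text \<open>The real logarithm has \<open>ln 0 = 0\<close>, so the definition below gives the correct value \<open>0\<close> at \<open>0\<close>.\<close>

definition log_plus :: "ennreal \<Rightarrow> ennreal" where
  "log_plus t = (if t = \<infinity> then \<infinity> else ennreal (max (ln (enn2real t)) 0))"

definition LlogL_norm :: "(real ^ 'n::finite) set \<Rightarrow> (real ^ 'n \<Rightarrow> ereal) \<Rightarrow> ennreal" where
  "LlogL_norm Q g =
     Inf {ennreal \<alpha> | \<alpha>. 0 < \<alpha> \<and>
       1 / emeasure lebesgue Q *
         (\<integral>\<^sup>+x\<in>Q. (e2ennreal \<bar>g x\<bar> / ennreal \<alpha> *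
            (1 + log_plus (e2ennreal \<bar>g x\<bar> / ennreal \<alpha>))) \<partial>lebesgue) \<le> 1}"

definition weak_LlogL_norm :: "(real ^ 'n::finite) set \<Rightarrow> (real ^ 'n \<Rightarrow> ereal) \<Rightarrow> ennreal" where
  "weak_LlogL_norm Q g =
     Inf {ennreal \<alpha> | \<alpha>. 0 < \<alpha> \<and>
       (SUP t\<in>{0::real<..}.
          1 / emeasure lebesgue Q *
            (emeasure lebesgue {x \<in> Q. \<bar>g x\<bar> > ereal (\<alpha> * t)} /
              (ennreal (1 / t) * (1 + log_plus (ennreal (1 / t)))))) \<le> 1}"

definition zygmund_morrey_norm :: "real \<Rightarrow> (real ^ 'n::finite \<Rightarrow> ereal) \<Rightarrow> ennreal" where
  "zygmund_morrey_norm lam f =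
     (SUP Q\<in>cubes. ennreal (measure lebesgue Q powr (lam / real CARD('n))) * LlogL_norm Q f)"

definition weak_zygmund_morrey_norm :: "real \<Rightarrow> (real ^ 'n::finite \<Rightarrow> ereal) \<Rightarrow> ennreal" where
  "weak_zygmund_morrey_norm lam f =
     (SUP Q\<in>cubes. ennreal (measure lebesgue Q powr (lam / real CARD('n))) * weak_LlogL_norm Q f)"

definition zygmund_morrey :: "real \<Rightarrow> (real ^ 'n::finite \<Rightarrow> ereal) set" where
  "zygmund_morrey lam =
     {f. f \<in> borel_measurable lebesgue \<and> zygmund_morrey_norm lam f < \<infinity>}"

definition weak_zygmund_morrey :: "real \<Rightarrow> (real ^ 'n::finite \<Rightarrow> ereal) set" where
  "weak_zygmund_morrey lam =
     {f. f \<in> borel_measurable lebesgue \<and> weak_zygmund_morrey_norm lam f < \<infinity>}"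

end

theory Submission imports Defs begin

text \<open>
  Why the theorem holds. In the weak norm the bound \<open>(1 / t) * (1 + log_plus (1 / t))\<close> equals \<open>1 / t\<close> for
  \<open>t \<ge> 1\<close>, and for \<open>t \<le> 1\<close> it is at least \<open>1\<close>, so that the condition is then empty. The weak norm on a cube is
  therefore the weak \<open>L\<^sup>1\<close> norm, and two facts suffice: \<open>M f\<close> satisfies an \<open>L\<^sup>1\<close> Morrey condition,
  and \<open>M\<close> maps an \<open>L\<^sup>1\<close> Morrey condition to a weak one.

  Both facts come from the same localization (\<open>maximal_localize\<close>). If \<open>x\<close> lies in \<open>Q\<close>, a cube through \<open>x\<close> that is
  no larger than \<open>Q\<close> lies in the triple \<open>3Q\<close>, so only the part of the function on \<open>3Q\<close> matters for it; the averages
  over larger cubes are controlled by the Morrey condition, whose bound decreases with the size of the cube.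

  First fact (\<open>integral_maximal_le\<close>): the local part \<open>f 1\<^sub>3\<^sub>Q\<close>, divided by an admissible \<open>\<alpha>\<close> of its norm, is
  handled by Stein's inequality \<open>\<integral>\<^sub>P M g \<le> |P| + C \<integral> g (1 + log_plus g)\<close> (\<open>maximal_LlogL\<close>), which follows by summing
  over dyadic levels the weak type \<open>(1,1)\<close> bound applied to \<open>g\<close> truncated from below (\<open>maximal_weak_type_truncated\<close>).
  Second fact (\<open>maximal_maximal_weak\<close>): the local part of \<open>M f\<close> is integrable by the first fact, and the weak type
  bound \<open>maximal_weak_type\<close>, a consequence of Vitali's covering lemma, applies to it.

  The argument runs with an arbitrary \<open>\<nu>\<close> strictly above the norm of \<open>f\<close> and a limit \<open>\<nu> \<rightarrow>\<close> norm at the end; this avoids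
  asking whether the infimum in the norm is attained, and covers functions of norm \<open>0\<close>.
\<close>

section \<open>Cubes and the maximal operator\<close>

definition cube :: "real ^ 'n::finite \<Rightarrow> real \<Rightarrow> (real ^ 'n) set" where
  "cube a l = cbox a (a + (\<chi> i. l))"

definition triple :: "real ^ 'n::finite \<Rightarrow> real \<Rightarrow> (real ^ 'n) set" where
  "triple a l = cube (a - (\<chi> i. l)) (3 * l)"

text \<open>The Hardy-Littlewood operator on nonnegative functions, free of the detour through \<^typ>\<open>ereal\<close>.\<close>

definition maximal :: "(real ^ 'n::finite \<Rightarrow> ennreal) \<Rightarrow> real ^ 'n \<Rightarrow> ennreal" where
  "maximal g x = (SUP Q\<in>{Q \<in> cubes. x \<in> Q}.
     1 / emeasure lebesgue Q * (\<integral>\<^sup>+y\<in>Q. g y \<partial>lebesgue))"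

lemma hl_maximal_eq_maximal:
  "hl_maximal f x = enn2ereal (maximal (\<lambda>y. e2ennreal \<bar>f y\<bar>) x)"
  by (simp add: hl_maximal_def maximal_def)

lemma e2ennreal_abs_hl_maximal:
  "e2ennreal \<bar>hl_maximal f x\<bar> = maximal (\<lambda>y. e2ennreal \<bar>f y\<bar>) x"
  by (simp add: hl_maximal_eq_maximal)

lemma cubes_iff: "Q \<in> cubes \<longleftrightarrow> (\<exists>a l. 0 < l \<and> Q = cube a l)"
  by (auto simp: cubes_def cube_def)

lemma mem_cube: "x \<in> cube a l \<longleftrightarrow> (\<forall>i. a $ i \<le> x $ i \<and> x $ i \<le> a $ i + l)"
  by (simp add: cube_def mem_box_cart)

lemma sets_cube [measurable, simp]: "cube a l \<in> sets lebesgue"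
  by (simp add: cube_def)

lemma sets_triple [measurable, simp]: "triple a l \<in> sets lebesgue"
  by (simp add: triple_def)

lemma emeasure_cube:
  fixes a :: "real ^ 'n::finite"
  assumes "0 \<le> l"
  shows "emeasure lebesgue (cube a l) = ennreal (l ^ CARD('n))"
proof -
  have "emeasure lebesgue (cube a l) = ennreal (measure lebesgue (cube a l))"
    unfolding cube_def by (intro emeasure_eq_ennreal_measure) (simp add: emeasure_lborel_cbox_eq)
  moreover have "measure lebesgue (cube a l) = l ^ CARD('n)"
  proof -
    have "cbox a (a + (\<chi> i. l)) \<noteq> {}"
      using assms by (auto simp: box_ne_empty cart_eq_inner_axis[symmetric] Basis_vec_def inner_axis)
    then show ?thesis
      unfolding cube_def by (simp add: content_cbox_cart)
  qed
  ultimately show ?thesis by simp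
qed

lemma measure_cube:
  fixes a :: "real ^ 'n::finite"
  assumes "0 \<le> l"
  shows "measure lebesgue (cube a l) = l ^ CARD('n)"
  unfolding measure_def emeasure_cube[OF assms] using assms by simp

lemma cube_subset_triple:
  assumes "x \<in> cube a l" "x \<in> cube b m" "m \<le> l"
  shows "cube b m \<subseteq> triple a l"
proof
  fix y assume y: "y \<in> cube b m"
  show "y \<in> triple a l"
    unfolding triple_def mem_cube
  proof
    fix i
    have "a $ i \<le> x $ i \<and> x $ i \<le> a $ i + l" "b $ i \<le> x $ i \<and> x $ i \<le> b $ i + m"
      "b $ i \<le> y $ i \<and> y $ i \<le> b $ i + m"
      using assms y by (auto simp: mem_cube)
    then show "(a - (\<chi> i. l)) $ i \<le> y $ i \<and> y $ i \<le> (a - (\<chi> i. l)) $ i + 3 * l"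
      using assms(3) by simp
  qed
qed

section \<open>The maximal function: level sets, measurability, localization\<close>

text \<open>Multiplied by the volume, an average compared with a real threshold becomes an integral, and the upper bounds
  below are stated for integrals.\<close>

lemma average_gt_iff:
  fixes a :: "real ^ 'n::finite"
  assumes "0 < l" "0 \<le> s"
  shows "ennreal s < 1 / emeasure lebesgue (cube a l) * I \<longleftrightarrow> ennreal (s * l ^ CARD('n)) < I"
proof -
  define v where "v = l ^ CARD('n)"
  have v: "0 < v" using assms by (simp add: v_def)
  have e: "1 / ennreal v = ennreal (1 / v)"
    using divide_ennreal[of 1 v] v by simp
  show ?thesis
  proof (cases I)
    case (real r)
    then show ?thesis
      unfolding emeasure_cube[OF less_imp_le[OF assms(1)]] v_def[symmetric] e
      using assms v by (simp add: ennreal_mult[symmetric] ennreal_less_iff) (simp add: field_simps)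
  next
    case top
    then show ?thesis
      unfolding emeasure_cube[OF less_imp_le[OF assms(1)]] v_def[symmetric] e
      using v by (simp add: ennreal_mult_top)
  qed
qed

lemma less_maximal_iff:
  fixes g :: "real ^ 'n::finite \<Rightarrow> ennreal"
  assumes "0 \<le> s"
  shows "ennreal s < maximal g x \<longleftrightarrow>
    (\<exists>a l. 0 < l \<and> x \<in> cube a l \<and> ennreal (s * l ^ CARD('n)) < (\<integral>\<^sup>+y\<in>cube a l. g y \<partial>lebesgue))"
proof -
  have "ennreal s < maximal g x \<longleftrightarrow> (\<exists>a l. 0 < l \<and> x \<in> cube a l \<and>
      ennreal s < 1 / emeasure lebesgue (cube a l) * (\<integral>\<^sup>+y\<in>cube a l. g y \<partial>lebesgue))"
    unfolding maximal_def less_SUP_iff cubes_iff by blast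
  then show ?thesis
    using average_gt_iff[OF _ assms] by blast
qed

lemma maximal_le_iff:
  fixes g :: "real ^ 'n::finite \<Rightarrow> ennreal"
  assumes "0 \<le> s"
  shows "maximal g x \<le> ennreal s \<longleftrightarrow>
    (\<forall>a l. 0 < l \<longrightarrow> x \<in> cube a l \<longrightarrow> (\<integral>\<^sup>+y\<in>cube a l. g y \<partial>lebesgue) \<le> ennreal (s * l ^ CARD('n)))"
  using less_maximal_iff[OF assms, of g x] by (auto simp: not_less[symmetric])

text \<open>The cubes are closed, but a strict lower bound for the average over a cube survives a small concentric dilation,
  and the dilated cube contains a ball around each point of the original one.\<close>

lemma open_less_maximal:
  fixes g :: "real ^ 'n::finite \<Rightarrow> ennreal"
  assumes s: "0 \<le> s"
  shows "open {x. ennreal s < maximal g x}"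
  unfolding open_contains_ball
proof (intro ballI)
  fix x assume "x \<in> {x. ennreal s < maximal g x}"
  then obtain a l where al: "0 < l" "x \<in> cube a l"
    and big: "ennreal (s * l ^ CARD('n)) < (\<integral>\<^sup>+y\<in>cube a l. g y \<partial>lebesgue)"
    by (auto simp: less_maximal_iff[OF s])
  have "((\<lambda>d. ennreal (s * (l + 2 * d) ^ CARD('n))) \<longlongrightarrow> ennreal (s * (l + 2 * 0) ^ CARD('n))) (at_right 0)"
    by (intro tendsto_intros)
  then have "\<forall>\<^sub>F d in at_right 0. ennreal (s * (l + 2 * d) ^ CARD('n)) < (\<integral>\<^sup>+y\<in>cube a l. g y \<partial>lebesgue)"
    using order_tendstoD(2) big by fastforce
  moreover have "\<forall>\<^sub>F d in at_right (0::real). 0 < d"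
    by (rule eventually_at_right_less)
  ultimately obtain d where d: "0 < d"
    "ennreal (s * (l + 2 * d) ^ CARD('n)) < (\<integral>\<^sup>+y\<in>cube a l. g y \<partial>lebesgue)"
    using eventually_happens[OF eventually_conj] by (metis (mono_tags, lifting) trivial_limit_at_right_real)
  define b where "b = a - (\<chi> i. d)"
  have sub: "cube a l \<subseteq> cube b (l + 2 * d)"
  proof
    fix z assume "z \<in> cube a l"
    then have "a $ i \<le> z $ i \<and> z $ i \<le> a $ i + l" for i
      by (simp add: mem_cube)
    then have 1: "a $ i \<le> z $ i" "z $ i \<le> a $ i + l" for i
      by simp_all
    show "z \<in> cube b (l + 2 * d)"
      unfolding mem_cube b_def
    proof
      fix i
      show "(a - (\<chi> i. d)) $ i \<le> z $ i \<and> z $ i \<le> (a - (\<chi> i. d)) $ i + (l + 2 * d)"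
        using 1[of i] d(1) by simp
    qed
  qed
  have "(\<integral>\<^sup>+y\<in>cube a l. g y \<partial>lebesgue) \<le> (\<integral>\<^sup>+y\<in>cube b (l + 2 * d). g y \<partial>lebesgue)"
    using sub by (intro nn_integral_mono) (auto simp: indicator_def)
  with d(2) have big': "ennreal (s * (l + 2 * d) ^ CARD('n)) < (\<integral>\<^sup>+y\<in>cube b (l + 2 * d). g y \<partial>lebesgue)"
    by (rule less_le_trans)
  have "ball x d \<subseteq> cube b (l + 2 * d)"
  proof
    fix z assume "z \<in> ball x d"
    then have "\<bar>(z - x) $ i\<bar> < d" for i
      using component_le_norm_cart[of "z - x" i] by (simp add: dist_norm norm_minus_commute)
    then have 1: "\<bar>z $ i - x $ i\<bar> < d" for i by simp
    have 2: "a $ i \<le> x $ i \<and> x $ i \<le> a $ i + l" for i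
      using al by (simp add: mem_cube)
    show "z \<in> cube b (l + 2 * d)"
      unfolding mem_cube b_def
    proof
      fix i
      show "(a - (\<chi> i. d)) $ i \<le> z $ i \<and> z $ i \<le> (a - (\<chi> i. d)) $ i + (l + 2 * d)"
        using 1[of i] 2[of i] by (simp add: abs_less_iff)
    qed
  qed
  moreover have "cube b (l + 2 * d) \<subseteq> {x. ennreal s < maximal g x}"
  proof
    fix z assume z: "z \<in> cube b (l + 2 * d)"
    have "0 < l + 2 * d" using al d by simp
    with z big' show "z \<in> {x. ennreal s < maximal g x}"
      by (auto simp: less_maximal_iff[OF s])
  qed
  ultimately show "\<exists>e>0. ball x e \<subseteq> {x. ennreal s < maximal g x}"
    using d(1) by blast
qed

lemma borel_measurable_maximal [measurable]: "maximal g \<in> borel_measurable lebesgue"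
proof -
  have "{x \<in> space borel. y < maximal g x} \<in> sets borel" for y
  proof (cases y)
    case (real r)
    then show ?thesis
      using open_less_maximal[of r g] by simp
  next
    case top
    then show ?thesis by simp
  qed
  then have "maximal g \<in> borel_measurable borel"
    by (rule borel_measurableI_greater)
  then show ?thesis
    by (intro measurable_completion) simp
qed

lemma sets_less_maximal [measurable, simp]: "{x. ennreal s < maximal g x} \<in> sets lebesgue"
proof -
  have "{x \<in> space lebesgue. ennreal s < maximal g x} \<in> sets lebesgue" by measurable
  then show ?thesis by simp
qed

lemma maximal_cmult_le:
  assumes [measurable]: "g \<in> borel_measurable lebesgue"
  shows "maximal (\<lambda>y. c * g y) x \<le> c * maximal g x"
  unfolding maximal_def
proof (rule SUP_least)
  fix Q :: "(real ^ 'a) set" assume Q: "Q \<in> {Q \<in> cubes. x \<in> Q}"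
  then have [measurable]: "Q \<in> sets lebesgue" by (auto simp: cubes_iff)
  have "1 / emeasure lebesgue Q * (\<integral>\<^sup>+y\<in>Q. c * g y \<partial>lebesgue)
      = c * (1 / emeasure lebesgue Q * (\<integral>\<^sup>+y\<in>Q. g y \<partial>lebesgue))"
    by (simp add: mult.assoc nn_integral_cmult mult.left_commute)
  also have "\<dots> \<le> c * (SUP Q\<in>{Q \<in> cubes. x \<in> Q}. 1 / emeasure lebesgue Q * (\<integral>\<^sup>+y\<in>Q. g y \<partial>lebesgue))"
    by (intro mult_left_mono SUP_upper Q) simp
  finally show "1 / emeasure lebesgue Q * (\<integral>\<^sup>+y\<in>Q. c * g y \<partial>lebesgue) \<le> \<dots>" .
qed

text \<open>A cube through \<open>x \<in> cube a l\<close> of side at most \<open>l\<close> stays inside the triple; the larger ones are left to the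
  assumption on averages.\<close>

lemma maximal_localize:
  fixes F :: "real ^ 'n::finite \<Rightarrow> ennreal"
  assumes x: "x \<in> cube a l" and W: "0 \<le> W"
    and far: "\<And>b m. l < m \<Longrightarrow> x \<in> cube b m \<Longrightarrow>
      (\<integral>\<^sup>+y\<in>cube b m. F y \<partial>lebesgue) \<le> ennreal (W * m ^ CARD('n))"
  shows "maximal F x \<le> max (maximal (\<lambda>y. F y * indicator (triple a l) y) x) (ennreal W)"
    (is "_ \<le> max (maximal ?G x) _")
proof (rule ccontr)
  assume "\<not> ?thesis"
  then have less: "max (maximal ?G x) (ennreal W) < maximal F x" by (simp add: not_le)
  then obtain s where s: "max (maximal ?G x) (ennreal W) = ennreal s" "0 \<le> s"
    by (cases "max (maximal ?G x) (ennreal W)") auto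
  then have Gs: "maximal ?G x \<le> ennreal s" and Ws: "W \<le> s"
    using W by (metis max.cobounded1, metis ennreal_le_iff max.cobounded2)
  obtain b m where bm: "0 < m" "x \<in> cube b m"
    and big: "ennreal (s * m ^ CARD('n)) < (\<integral>\<^sup>+y\<in>cube b m. F y \<partial>lebesgue)"
    using less s by (auto simp: less_maximal_iff)
  have "(\<integral>\<^sup>+y\<in>cube b m. F y \<partial>lebesgue) \<le> ennreal (s * m ^ CARD('n))"
  proof (cases "m \<le> l")
    case True
    have "(\<integral>\<^sup>+y\<in>cube b m. F y \<partial>lebesgue) = (\<integral>\<^sup>+y\<in>cube b m. ?G y \<partial>lebesgue)"
      using cube_subset_triple[OF x bm(2) True]
      by (intro nn_integral_cong) (auto simp: indicator_def)
    also have "\<dots> \<le> ennreal (s * m ^ CARD('n))"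
      using Gs bm s(2) by (simp add: maximal_le_iff)
    finally show ?thesis .
  next
    case False
    then have "(\<integral>\<^sup>+y\<in>cube b m. F y \<partial>lebesgue) \<le> ennreal (W * m ^ CARD('n))"
      using far bm by simp
    also have "\<dots> \<le> ennreal (s * m ^ CARD('n))"
      using Ws bm by (intro ennreal_leI mult_right_mono) auto
    finally show ?thesis .
  qed
  with big show False by simp
qed

section \<open>The weak type (1,1) inequality\<close>

text \<open>The counting half of a Vitali argument: a cover by sets \<open>X i\<close>, each comparable to its own member of a disjoint
  family \<open>Y i\<close>.\<close>

lemma emeasure_countable_cover_le:
  assumes C: "countable C"
    and X: "\<And>i. i \<in> C \<Longrightarrow> X i \<in> sets M"
    and Y: "\<And>i. i \<in> C \<Longrightarrow> Y i \<in> sets N" and disj: "disjoint_family_on Y C"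
    and le: "\<And>i. i \<in> C \<Longrightarrow> emeasure M (X i) \<le> c * emeasure N (Y i)"
  shows "emeasure M (\<Union>i\<in>C. X i) \<le> c * emeasure N (space N)"
proof -
  define D where "D = to_nat_on C ` C"
  define X' where "X' n = (if n \<in> D then X (from_nat_into C n) else {})" for n
  define Y' where "Y' n = (if n \<in> D then Y (from_nat_into C n) else {})" for n
  have mem: "n \<in> D \<Longrightarrow> from_nat_into C n \<in> C" for n
    using C by (auto simp: D_def)
  have "disjoint_family Y'"
    using disj mem C unfolding disjoint_family_on_def Y'_def D_def
    by auto blast
  have "(\<Union>i\<in>C. X i) \<subseteq> (\<Union>n. X' n)"
  proof
    fix x assume "x \<in> (\<Union>i\<in>C. X i)"
    then obtain i where "i \<in> C" "x \<in> X i" by auto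
    then have "x \<in> X' (to_nat_on C i)" using C by (simp add: X'_def D_def)
    then show "x \<in> (\<Union>n. X' n)" by auto
  qed
  then have "emeasure M (\<Union>i\<in>C. X i) \<le> emeasure M (\<Union>n. X' n)"
    using X mem by (intro emeasure_mono) (auto simp: X'_def)
  also have "\<dots> \<le> (\<Sum>n. emeasure M (X' n))"
    using X mem by (intro emeasure_subadditive_countably) (auto simp: X'_def)
  also have "\<dots> \<le> (\<Sum>n. c * emeasure N (Y' n))"
    using le mem by (intro suminf_le) (auto simp: X'_def Y'_def)
  also have "\<dots> = c * (\<Sum>n. emeasure N (Y' n))"
    by simp
  also have "(\<Sum>n. emeasure N (Y' n)) = emeasure N (\<Union>n. Y' n)"
    using Y mem by (intro suminf_emeasure \<open>disjoint_family Y'\<close>) (auto simp: Y'_def)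
  also have "c * \<dots> \<le> c * emeasure N (space N)"
    by (intro mult_left_mono emeasure_space) simp
  finally show ?thesis .
qed

text \<open>The ratio between the volume of a cube around the ball of five times the radius \<open>CARD('n) * l\<close>, which has side
  \<open>10 * CARD('n) * l\<close>, and the volume of the cube of side \<open>l\<close> in the Vitali argument.\<close>

definition weak_const :: "'n::finite itself \<Rightarrow> real" where
  "weak_const _ = (10 * real CARD('n)) ^ CARD('n)"

lemma weak_const_ge_1: "1 \<le> weak_const TYPE('n::finite)"
  unfolding weak_const_def
proof (rule one_le_power)
  have "1 \<le> CARD('n)" by (simp add: Suc_leI)
  then show "1 \<le> 10 * real CARD('n)" by linarith
qed

text \<open>The ball is centred at the corner of the cube; comparing with the \<open>l\<^sup>1\<close> norm gives the crude radius, which is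
  all that the covering argument needs.\<close>

lemma cube_subset_cball:
  fixes a :: "real ^ 'n::finite"
  shows "cube a l \<subseteq> cball a (real CARD('n) * l)"
proof
  fix x assume "x \<in> cube a l"
  then have "a $ i \<le> x $ i \<and> x $ i \<le> a $ i + l" for i by (simp add: mem_cube)
  then have 1: "a $ i \<le> x $ i" "x $ i \<le> a $ i + l" for i by simp_all
  have c: "\<bar>(x - a) $ i\<bar> \<le> l" for i using 1[of i] by simp
  have "norm (x - a) \<le> (\<Sum>i\<in>UNIV. \<bar>(x - a) $ i\<bar>)" by (rule norm_le_l1_cart)
  also have "\<dots> \<le> (\<Sum>i\<in>(UNIV::'n set). l)" by (intro sum_mono c)
  finally show "x \<in> cball a (real CARD('n) * l)"
    by (simp add: dist_norm norm_minus_commute)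
qed

lemma cball_subset_cube: "cball a r \<subseteq> cube (a - (\<chi> i. r)) (2 * r)"
proof
  fix x assume "x \<in> cball a r"
  then have "\<bar>(x - a) $ i\<bar> \<le> r" for i
    using component_le_norm_cart[of "x - a" i] by (simp add: dist_norm norm_minus_commute)
  then have 1: "\<bar>x $ i - a $ i\<bar> \<le> r" for i by simp
  show "x \<in> cube (a - (\<chi> i. r)) (2 * r)"
    unfolding mem_cube
  proof
    fix i
    show "(a - (\<chi> i. r)) $ i \<le> x $ i \<and> x $ i \<le> (a - (\<chi> i. r)) $ i + 2 * r"
      using 1[of i] by (simp add: abs_le_iff)
  qed
qed

text \<open>Each point of the level set lies in a cube over which \<open>g\<close> has integral larger than \<open>s\<close> times the volume. The balls
  that contain these cubes admit a disjoint subfamily whose fivefold dilations still cover, and the integrals of \<open>g\<close>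
  over the selected disjoint cubes add up to at most the total integral.\<close>

lemma maximal_weak_type:
  fixes g :: "real ^ 'n::finite \<Rightarrow> ennreal"
  assumes g[measurable]: "g \<in> borel_measurable lebesgue" and s: "0 < s"
  shows "emeasure lebesgue {x. ennreal s < maximal g x}
    \<le> ennreal (weak_const TYPE('n) / s) * (\<integral>\<^sup>+x. g x \<partial>lebesgue)"
proof (cases "\<integral>\<^sup>+x. g x \<partial>lebesgue")
  case top
  then show ?thesis
    using s weak_const_ge_1[where 'n='n] by (simp add: ennreal_mult_top)
next
  case (real I)
  \<comment> \<open>as a measure, \<open>N\<close> turns integrals of \<open>g\<close> over disjoint cubes into a countably additive sum\<close>
  define N where "N = density lebesgue g"
  define K where "K = {(a :: real ^ 'n, l). 0 < l \<and>
    ennreal (s * l ^ CARD('n)) < (\<integral>\<^sup>+y\<in>cube a l. g y \<partial>lebesgue)}"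
  have card: "1 \<le> real CARD('n)"
    by (metis One_nat_def Suc_leI of_nat_1 of_nat_le_iff zero_less_card_finite)
  let ?a = "fst :: (real ^ 'n) \<times> real \<Rightarrow> _" and ?r = "\<lambda>p :: (real ^ 'n) \<times> real. real CARD('n) * snd p"
  have vol: "s * snd p ^ CARD('n) < I" if "p \<in> K" for p
  proof -
    have "ennreal (s * snd p ^ CARD('n)) < (\<integral>\<^sup>+y\<in>cube (fst p) (snd p). g y \<partial>lebesgue)"
      using that by (auto simp: K_def)
    also have "\<dots> \<le> (\<integral>\<^sup>+x. g x \<partial>lebesgue)"
      by (intro nn_integral_mono) (auto simp: indicator_def)
    finally show ?thesis
      using real s that by (auto simp: K_def ennreal_less_iff)
  qed
  \<comment> \<open>the covering lemma needs bounded radii: a cube with a large average has bounded volume\<close>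
  have rad: "0 < ?r p \<and> ?r p \<le> real CARD('n) * (1 + I / s)" if "p \<in> K" for p
  proof -
    have pos: "0 < snd p" using that by (auto simp: K_def)
    have "snd p \<le> 1 + I / s"
    proof (cases "snd p \<le> 1")
      case True
      then show ?thesis using real s by (simp add: add_increasing2)
    next
      case False
      then have "snd p \<le> snd p ^ CARD('n)" by (intro self_le_power) auto
      also have "\<dots> \<le> I / s" using vol[OF that] s by (simp add: field_simps)
      finally show ?thesis by simp
    qed
    then show ?thesis using pos card by simp
  qed
  have cov: "{x. ennreal s < maximal g x} \<subseteq> (\<Union>p\<in>K. cball (?a p) (?r p))"
  proof
    fix x assume "x \<in> {x. ennreal s < maximal g x}"
    then obtain a l where "(a, l) \<in> K" "x \<in> cube a l"
      using s by (auto simp: less_maximal_iff K_def)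
    then show "x \<in> (\<Union>p\<in>K. cball (?a p) (?r p))"
      using cube_subset_cball[of a l] by force
  qed
  obtain C where C: "countable C" "C \<subseteq> K"
    "pairwise (\<lambda>i j. disjnt (cball (?a i) (?r i)) (cball (?a j) (?r j))) C"
    "{x. ennreal s < maximal g x} \<subseteq> (\<Union>i\<in>C. cball (?a i) (5 * ?r i))"
    using Vitali_covering_lemma_cballs[OF cov rad] by blast
  have sub: "{x. ennreal s < maximal g x} \<subseteq>
      (\<Union>p\<in>C. cube (fst p - (\<chi> i. 5 * ?r p)) (2 * (5 * ?r p)))" (is "_ \<subseteq> (\<Union>p\<in>C. ?X p)")
    using C(4) cball_subset_cube by blast
  have "emeasure lebesgue {x. ennreal s < maximal g x} \<le> emeasure lebesgue (\<Union>p\<in>C. ?X p)"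
    using C(1) by (intro emeasure_mono[OF sub] sets.countable_UN') auto
  also have "\<dots> \<le> ennreal (weak_const TYPE('n) / s) * emeasure N (space N)"
  proof (rule emeasure_countable_cover_le[OF C(1)])
    fix p assume p: "p \<in> C"
    then have pK: "p \<in> K" using C(2) by auto
    show "?X p \<in> sets lebesgue" by simp
    show "cube (fst p) (snd p) \<in> sets N" by (simp add: N_def)
    have pos: "0 < snd p" using pK by (auto simp: K_def)
    have "emeasure lebesgue (?X p) = ennreal ((2 * (5 * ?r p)) ^ CARD('n))"
      using pos by (subst emeasure_cube) auto
    also have "(2 * (5 * ?r p)) ^ CARD('n) = weak_const TYPE('n) / s * (s * snd p ^ CARD('n))"
      using s by (simp add: weak_const_def power_mult_distrib)
    also have "ennreal \<dots> = ennreal (weak_const TYPE('n) / s) * ennreal (s * snd p ^ CARD('n))"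
      using s pos weak_const_ge_1[where 'n='n] by (intro ennreal_mult) auto
    also have "\<dots> \<le> ennreal (weak_const TYPE('n) / s) * emeasure N (cube (fst p) (snd p))"
      using pK by (intro mult_left_mono) (auto simp: K_def N_def emeasure_density)
    finally show "emeasure lebesgue (?X p) \<le> \<dots>" .
  next
    have "cube (fst p) (snd p) \<subseteq> cball (?a p) (?r p)" for p :: "(real ^ 'n) \<times> real"
      by (rule cube_subset_cball)
    then show "disjoint_family_on (\<lambda>p. cube (fst p) (snd p)) C"
      using C(3) unfolding disjoint_family_on_def pairwise_def disjnt_def by blast
  qed
  also have "emeasure N (space N) = (\<integral>\<^sup>+x. g x \<partial>lebesgue)"
    by (simp add: N_def emeasure_density)
  finally show ?thesis .
qed

section \<open>Integrability of the maximal function of an L log L function\<close>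

text \<open>The part of \<open>g\<close> below \<open>s / 2\<close> contributes at most \<open>s / 2\<close> to any average.\<close>

lemma less_maximal_truncate:
  fixes g :: "real ^ 'n::finite \<Rightarrow> ennreal"
  assumes [measurable]: "g \<in> borel_measurable lebesgue" and s: "0 < s"
    and x: "ennreal s < maximal g x"
  shows "ennreal (s / 2) < maximal (\<lambda>y. g y * indicator {ennreal (s / 2)<..} (g y)) x"
    (is "_ < maximal ?h x")
proof (rule ccontr)
  assume "\<not> ?thesis"
  then have small: "maximal ?h x \<le> ennreal (s / 2)" by simp
  obtain a l where al: "0 < l" "x \<in> cube a l"
    and big: "ennreal (s * l ^ CARD('n)) < (\<integral>\<^sup>+y\<in>cube a l. g y \<partial>lebesgue)"
    using x s by (auto simp: less_maximal_iff)
  have "(\<integral>\<^sup>+y\<in>cube a l. g y \<partial>lebesgue) \<le>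
      (\<integral>\<^sup>+y. ?h y * indicator (cube a l) y + ennreal (s / 2) * indicator (cube a l) y \<partial>lebesgue)"
    by (intro nn_integral_mono) (auto simp: indicator_def)
  also have "\<dots> = (\<integral>\<^sup>+y\<in>cube a l. ?h y \<partial>lebesgue) + ennreal (s / 2) * emeasure lebesgue (cube a l)"
    by (subst nn_integral_add) (auto simp: nn_integral_cmult_indicator)
  also have "\<dots> \<le> ennreal (s / 2 * l ^ CARD('n)) + ennreal (s / 2 * l ^ CARD('n))"
  proof (intro add_mono)
    show "(\<integral>\<^sup>+y\<in>cube a l. ?h y \<partial>lebesgue) \<le> ennreal (s / 2 * l ^ CARD('n))"
      using small s al by (subst (asm) maximal_le_iff) auto
    show "ennreal (s / 2) * emeasure lebesgue (cube a l) \<le> ennreal (s / 2 * l ^ CARD('n))"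
      using s al by (subst emeasure_cube) (auto simp flip: ennreal_mult)
  qed
  also have "\<dots> = ennreal (s * l ^ CARD('n))"
    using s al by (simp flip: ennreal_plus)
  finally show False using big by simp
qed

text \<open>On the level \<open>s\<close> only the values of \<open>g\<close> above \<open>s / 2\<close> count; this localization in height is what makes the sum over
  dyadic levels produce a logarithm.\<close>

lemma maximal_weak_type_truncated:
  fixes g :: "real ^ 'n::finite \<Rightarrow> ennreal"
  assumes [measurable]: "g \<in> borel_measurable lebesgue" and s: "0 < s"
  shows "ennreal s * emeasure lebesgue {x. ennreal s < maximal g x}
    \<le> ennreal (2 * weak_const TYPE('n)) * (\<integral>\<^sup>+x. g x * indicator {ennreal (s / 2)<..} (g x) \<partial>lebesgue)"
proof -
  let ?h = "\<lambda>y. g y * indicator {ennreal (s / 2)<..} (g y)"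
  have "emeasure lebesgue {x. ennreal s < maximal g x} \<le> emeasure lebesgue {x. ennreal (s / 2) < maximal ?h x}"
    using less_maximal_truncate[OF assms] by (intro emeasure_mono) auto
  also have "\<dots> \<le> ennreal (weak_const TYPE('n) / (s / 2)) * (\<integral>\<^sup>+x. ?h x \<partial>lebesgue)"
    using s by (intro maximal_weak_type) auto
  finally have "ennreal s * emeasure lebesgue {x. ennreal s < maximal g x} \<le>
      ennreal s * (ennreal (weak_const TYPE('n) / (s / 2)) * (\<integral>\<^sup>+x. ?h x \<partial>lebesgue))"
    by (rule mult_left_mono) simp
  also have "\<dots> = ennreal (s * (weak_const TYPE('n) / (s / 2))) * (\<integral>\<^sup>+x. ?h x \<partial>lebesgue)"
    using s weak_const_ge_1[where 'n='n] by (subst ennreal_mult) (auto simp: mult.assoc)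
  also have "s * (weak_const TYPE('n) / (s / 2)) = 2 * weak_const TYPE('n)"
    using s by simp
  finally show ?thesis .
qed

text \<open>A discrete layer-cake formula: if \<open>n\<close> is least with \<open>v \<le> 2 ^ n\<close>, the levels below \<open>n\<close> contribute \<open>2 ^ n - 1\<close>.\<close>

lemma dyadic_sum_ge:
  fixes v :: ennreal
  shows "v \<le> 1 + (\<Sum>k. ennreal (2 ^ k) * indicator {ennreal (2 ^ k)<..} v)" (is "_ \<le> 1 + ?S")
proof -
  \<comment> \<open>partial sums already reach \<open>2 ^ n\<close>; for \<open>v = top\<close> this holds for every \<open>n\<close> and forces an infinite sum\<close>
  have reach: "ennreal (2 ^ n) \<le> 1 + ?S" if "\<And>k. k < n \<Longrightarrow> ennreal (2 ^ k) < v" for n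
  proof -
    have "(2::real) ^ n = 1 + (\<Sum>k<n. 2 ^ k)"
      by (induction n) auto
    then have "ennreal (2 ^ n) = ennreal 1 + ennreal (\<Sum>k<n. 2 ^ k)"
      by (subst ennreal_plus[symmetric]) (auto intro: sum_nonneg)
    also have "ennreal (\<Sum>k<n. 2 ^ k) = (\<Sum>k<n. ennreal (2 ^ k))"
      by (rule sum_ennreal[symmetric]) simp
    also have "\<dots> = (\<Sum>k<n. ennreal (2 ^ k) * indicator {ennreal (2 ^ k)<..} v)"
      using that by (intro sum.cong) auto
    also have "ennreal 1 + \<dots> = 1 + (\<Sum>k<n. ennreal (2 ^ k) * indicator {ennreal (2 ^ k)<..} v)"
      by simp
    also have "\<dots> \<le> 1 + ?S"
      by (intro add_left_mono sum_le_suminf) auto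
    finally show ?thesis .
  qed
  show ?thesis
  proof (cases v)
    case (real r)
    obtain n0 :: nat where "r < 2 ^ n0" using real_arch_pow[of 2 r] by auto
    then have "v \<le> ennreal (2 ^ n0)" unfolding real by (intro ennreal_leI) simp
    then have ex: "\<exists>n. v \<le> ennreal (2 ^ n)" by blast
    define n where "n = (LEAST n. v \<le> ennreal (2 ^ n))"
    have "v \<le> ennreal (2 ^ n)" unfolding n_def using ex by (rule LeastI_ex)
    also have "\<dots> \<le> 1 + ?S"
    proof (rule reach)
      fix k assume "k < n"
      then show "ennreal (2 ^ k) < v"
        using not_less_Least[of k "\<lambda>n. v \<le> ennreal (2 ^ n)", folded n_def] by (simp only: not_le)
    qed
    finally show ?thesis .
  next
    case top
    have "1 + ?S = top"
    proof (rule ccontr)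
      assume "1 + ?S \<noteq> top"
      then obtain r where r: "1 + ?S = ennreal r" "0 \<le> r" by (cases "1 + ?S") auto
      obtain n :: nat where "r < 2 ^ n" using real_arch_pow[of 2 r] by auto
      have "ennreal (2 ^ n) \<le> ennreal r"
        unfolding r(1)[symmetric] by (rule reach) (simp add: top)
      then have "2 ^ n \<le> r" using r(2) by (simp only: ennreal_le_iff)
      with \<open>r < 2 ^ n\<close> show False by simp
    qed
    then show ?thesis by simp
  qed
qed

text \<open>The number of dyadic levels below \<open>2 u\<close> is logarithmic in \<open>u\<close>; this is the source of the factor \<open>1 + log_plus\<close>.\<close>

lemma dyadic_count_le:
  "(\<Sum>k. indicator {ennreal (2 ^ k / 2)<..} u) \<le> 2 * (1 + log_plus u)"
proof (cases u)
  case (real r)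
  obtain n0 :: nat where "2 * r < 2 ^ n0" using real_arch_pow[of 2 "2 * r"] by auto
  then have ex: "\<exists>n. r \<le> 2 ^ n / 2" by (intro exI[of _ n0]) simp
  \<comment> \<open>the number of levels \<open>2 ^ k / 2\<close> below \<open>u\<close>\<close>
  define n where "n = (LEAST n. r \<le> 2 ^ n / 2)"
  have n: "r \<le> 2 ^ n / 2" unfolding n_def using ex by (rule LeastI_ex)
  have "indicator {ennreal (2 ^ k / 2)<..} u = (0::ennreal)" if "k \<notin> {..<n}" for k
  proof -
    have "(2::real) ^ n \<le> 2 ^ k" using that by (intro power_increasing) auto
    then have "r \<le> 2 ^ k / 2" using n by linarith
    then show ?thesis using real by (simp add: indicator_def not_less)
  qed
  then have "(\<Sum>k. indicator {ennreal (2 ^ k / 2)<..} u) = (\<Sum>k<n. indicator {ennreal (2 ^ k / 2)<..} u :: ennreal)"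
    by (intro suminf_finite) auto
  also have "\<dots> \<le> (\<Sum>k<n. 1)" by (intro sum_mono) (simp add: indicator_def)
  also have "\<dots> = ennreal (real n)" by (simp add: ennreal_of_nat_eq_real_of_nat)
  also have "real n \<le> 2 * (1 + max (ln r) 0)"
  proof (cases "n \<le> 2")
    case False
    then have m: "n = Suc (Suc (n - 2))" "0 < n - 2" by simp_all
    define m where "m = n - 2"
    note m = m[folded m_def]
    have "\<not> r \<le> 2 ^ Suc m / 2"
      using not_less_Least[of "Suc m" "\<lambda>n. r \<le> 2 ^ n / 2", folded n_def] m(1) by auto
    then have "2 ^ m < r" by simp
    then have "ln (2 ^ m) < ln r" by (subst ln_less_cancel_iff) (auto intro: less_trans[OF _ \<open>2 ^ m < r\<close>])
    then have "real m * ln 2 < ln r" by (simp add: ln_realpow)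
    \<comment> \<open>\<open>1 / 2\<close> is a convenient rational lower bound for \<open>ln 2\<close>; it yields the factor \<open>2\<close> in the claim\<close>
    moreover have "real m * (1 / 2) \<le> real m * ln 2"
      using ln2_ge_two_thirds by (intro mult_left_mono) auto
    ultimately have "real m < 2 * ln r" by simp
    moreover have "real n = real m + 2" using m by simp
    moreover have "2 * ln r \<le> 2 * max (ln r) 0" by simp
    ultimately have "real n \<le> 2 + 2 * max (ln r) 0" by simp
    then show ?thesis by (simp add: distrib_left)
  qed simp
  also have "ennreal (2 * (1 + max (ln r) 0)) = 2 * (1 + log_plus u)"
    using real by (simp add: log_plus_def ennreal_mult)
  finally show ?thesis by (simp add: ennreal_leI)
next
  case top
  then show ?thesis by (simp add: log_plus_def ennreal_mult_top)
qed

text \<open>Stein's inequality. The layer-cake sum costs \<open>2 ^ k\<close> times the measure of the level set at \<open>2 ^ k\<close>, the truncated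
  weak type bound cancels the factor \<open>2 ^ k\<close>, and exchanging sum and integral counts, at each point, the levels below
  \<open>2 g\<close>.\<close>

lemma maximal_LlogL:
  fixes g :: "real ^ 'n::finite \<Rightarrow> ennreal"
  assumes [measurable]: "g \<in> borel_measurable lebesgue" "P \<in> sets lebesgue"
  shows "(\<integral>\<^sup>+x\<in>P. maximal g x \<partial>lebesgue) \<le>
    emeasure lebesgue P + ennreal (4 * weak_const TYPE('n)) * (\<integral>\<^sup>+x. g x * (1 + log_plus (g x)) \<partial>lebesgue)"
proof -
  define C where "C = 2 * weak_const TYPE('n)"
  have C: "0 \<le> C" using weak_const_ge_1[where 'n='n] by (simp add: C_def)
  let ?E = "\<lambda>k::nat. {x. ennreal (2 ^ k) < maximal g x}"
  have "(\<integral>\<^sup>+x\<in>P. maximal g x \<partial>lebesgue) \<le>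
      (\<integral>\<^sup>+x. indicator P x + (\<Sum>k. ennreal (2 ^ k) * indicator (?E k) x) \<partial>lebesgue)"
  proof (rule nn_integral_mono)
    fix x
    have "maximal g x \<le> 1 + (\<Sum>k. ennreal (2 ^ k) * indicator (?E k) x)"
    proof -
      have "indicator {ennreal (2 ^ k)<..} (maximal g x) = (indicator (?E k) x :: ennreal)" for k :: nat
        by (auto simp: indicator_def)
      then show ?thesis using dyadic_sum_ge[of "maximal g x"] by (simp only: )
    qed
    then show "maximal g x * indicator P x \<le> indicator P x + (\<Sum>k. ennreal (2 ^ k) * indicator (?E k) x)"
      by (cases "x \<in> P") auto
  qed
  also have "\<dots> = emeasure lebesgue P + (\<Sum>k. ennreal (2 ^ k) * emeasure lebesgue (?E k))"
    by (subst nn_integral_add, simp, measurable)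
      (subst nn_integral_suminf, measurable, simp add: nn_integral_cmult_indicator)
  also have "(\<Sum>k. ennreal (2 ^ k) * emeasure lebesgue (?E k)) \<le>
      (\<Sum>k. ennreal C * (\<integral>\<^sup>+x. g x * indicator {ennreal (2 ^ k / 2)<..} (g x) \<partial>lebesgue))"
    unfolding C_def by (intro suminf_le maximal_weak_type_truncated) auto
  also have "\<dots> = ennreal C * (\<integral>\<^sup>+x. g x * (\<Sum>k. indicator {ennreal (2 ^ k / 2)<..} (g x)) \<partial>lebesgue)"
  proof -
    have "(\<Sum>k. \<integral>\<^sup>+x. g x * indicator {ennreal (2 ^ k / 2)<..} (g x) \<partial>lebesgue)
        = (\<integral>\<^sup>+x. (\<Sum>k. g x * indicator {ennreal (2 ^ k / 2)<..} (g x)) \<partial>lebesgue)"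
      by (rule nn_integral_suminf[symmetric]) measurable
    then show ?thesis by (simp only: ennreal_suminf_cmult)
  qed
  also have "\<dots> \<le> ennreal C * (\<integral>\<^sup>+x. g x * (2 * (1 + log_plus (g x))) \<partial>lebesgue)"
    by (intro mult_left_mono nn_integral_mono dyadic_count_le) auto
  also have "(\<integral>\<^sup>+x. g x * (2 * (1 + log_plus (g x))) \<partial>lebesgue) = 2 * (\<integral>\<^sup>+x. g x * (1 + log_plus (g x)) \<partial>lebesgue)"
  proof -
    have [measurable]: "log_plus \<in> borel_measurable borel"
      unfolding log_plus_def by measurable
    show ?thesis
      by (simp only: mult.left_commute[of _ 2]) (rule nn_integral_cmult, measurable)
  qed
  also have "ennreal C * (2 * (\<integral>\<^sup>+x. g x * (1 + log_plus (g x)) \<partial>lebesgue)) =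
      ennreal (4 * weak_const TYPE('n)) * (\<integral>\<^sup>+x. g x * (1 + log_plus (g x)) \<partial>lebesgue)"
  proof -
    have "ennreal (4 * weak_const TYPE('n)) = ennreal (C * 2)" by (simp add: C_def)
    also have "\<dots> = ennreal C * 2" using C by (subst ennreal_mult) auto
    finally show ?thesis by (simp add: mult.assoc)
  qed
  finally show ?thesis by (simp add: add_left_mono)
qed

section \<open>Morrey conditions\<close>

text \<open>One unit pays for the levels below \<open>1\<close> in Stein's inequality and one for the large cubes; the last term is the
  constant of that inequality times the volume ratio of a triple to its cube.\<close>

definition average_const :: "'n::finite itself \<Rightarrow> real" where
  "average_const _ = 2 + 4 * weak_const TYPE('n) * 3 ^ CARD('n)"

text \<open>Besides \<open>average_const\<close>, this absorbs the weak type constant and the volume ratio of a triple to its cube.\<close>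

definition morrey_const :: "'n::finite itself \<Rightarrow> real" where
  "morrey_const _ = weak_const TYPE('n) * 3 ^ CARD('n) * average_const TYPE('n)"

lemma average_const_ge_1: "1 \<le> average_const TYPE('n::finite)"
  using weak_const_ge_1[where 'n='n] by (simp add: average_const_def add_increasing2)

lemma average_const_le_morrey_const: "average_const TYPE('n::finite) \<le> morrey_const TYPE('n)"
proof -
  have "1 * 1 * average_const TYPE('n) \<le> weak_const TYPE('n) * 3 ^ CARD('n) * average_const TYPE('n)"
    using weak_const_ge_1[where 'n='n] average_const_ge_1[where 'n='n] by (intro mult_right_mono mult_mono) auto
  then show ?thesis by (simp add: morrey_const_def)
qed

lemma ennreal_mult_divide_cancel:
  "0 < \<alpha> \<Longrightarrow> ennreal \<alpha> * (v / ennreal \<alpha>) = v"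
  by (metis ennreal_eq_0_iff ennreal_mult_divide_eq ennreal_neq_top ennreal_times_divide mult.commute not_le)

text \<open>The Morrey condition with a general decreasing weight \<open>w\<close> of the side length in place of a multiple of
  \<open>|Q|\<close> to the power \<open>- lam / n\<close>; monotonicity carries bounds from large cubes
  to smaller ones.\<close>

locale LlogL_Morrey =
  fixes F :: "real ^ 'n::finite \<Rightarrow> ennreal" and w :: "real \<Rightarrow> real"
  assumes measurable_F [measurable]: "F \<in> borel_measurable lebesgue"
    and w_pos: "0 < l \<Longrightarrow> 0 < w l"
    and w_antimono: "0 < l \<Longrightarrow> l \<le> m \<Longrightarrow> w m \<le> w l"
    and LlogL: "0 < l \<Longrightarrow> \<exists>\<alpha>. 0 < \<alpha> \<and> \<alpha> \<le> w l \<and>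
      (\<integral>\<^sup>+x\<in>cube a l. (F x / ennreal \<alpha> * (1 + log_plus (F x / ennreal \<alpha>))) \<partial>lebesgue) \<le> ennreal (l ^ CARD('n))"
begin

text \<open>The \<open>L log L\<close> norm dominates the average.\<close>

lemma integral_cube_le:
  assumes "0 < m"
  shows "(\<integral>\<^sup>+x\<in>cube b m. F x \<partial>lebesgue) \<le> ennreal (w m * m ^ CARD('n))"
proof -
  obtain \<alpha> where \<alpha>: "0 < \<alpha>" "\<alpha> \<le> w m"
    "(\<integral>\<^sup>+x\<in>cube b m. (F x / ennreal \<alpha> * (1 + log_plus (F x / ennreal \<alpha>))) \<partial>lebesgue) \<le> ennreal (m ^ CARD('n))"
    using LlogL[OF assms] by blast
  have "(\<integral>\<^sup>+x\<in>cube b m. F x \<partial>lebesgue) = (\<integral>\<^sup>+x. ennreal \<alpha> * (F x / ennreal \<alpha> * indicator (cube b m) x) \<partial>lebesgue)"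
    using ennreal_mult_divide_cancel[OF \<alpha>(1)] by (simp add: mult.assoc[symmetric])
  also have "\<dots> = ennreal \<alpha> * (\<integral>\<^sup>+x. F x / ennreal \<alpha> * indicator (cube b m) x \<partial>lebesgue)"
    by (rule nn_integral_cmult) measurable
  also have "\<dots> \<le> ennreal \<alpha> * (\<integral>\<^sup>+x\<in>cube b m. (F x / ennreal \<alpha> * (1 + log_plus (F x / ennreal \<alpha>))) \<partial>lebesgue)"
  proof (intro mult_left_mono nn_integral_mono mult_right_mono)
    fix x
    have "F x / ennreal \<alpha> * 1 \<le> F x / ennreal \<alpha> * (1 + log_plus (F x / ennreal \<alpha>))"
      by (intro mult_left_mono) auto
    then show "F x / ennreal \<alpha> \<le> F x / ennreal \<alpha> * (1 + log_plus (F x / ennreal \<alpha>))" by simp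
  qed auto
  also have "\<dots> \<le> ennreal (w m) * ennreal (m ^ CARD('n))"
    using \<alpha> by (intro mult_mono ennreal_leI) auto
  also have "\<dots> = ennreal (w m * m ^ CARD('n))"
    using assms w_pos by (subst ennreal_mult) (auto intro: less_imp_le)
  finally show ?thesis .
qed

text \<open>Stein's inequality is not homogeneous, so it is applied to \<open>F / \<alpha>\<close> on the triple, with \<open>\<alpha>\<close> admissible for the norm
  there; the right-hand side is then a multiple of the volume. The constant falls one short of \<open>average_const\<close>, which
  leaves a unit for the larger cubes.\<close>

lemma integral_maximal_triple_le:
  assumes l: "0 < l"
  shows "(\<integral>\<^sup>+x\<in>cube a l. maximal (\<lambda>y. F y * indicator (triple a l) y) x \<partial>lebesgue)
    \<le> ennreal ((average_const TYPE('n) - 1) * w l * l ^ CARD('n))"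
proof -
  obtain \<alpha> where \<alpha>: "0 < \<alpha>" "\<alpha> \<le> w (3 * l)"
    "(\<integral>\<^sup>+x\<in>triple a l. (F x / ennreal \<alpha> * (1 + log_plus (F x / ennreal \<alpha>))) \<partial>lebesgue)
      \<le> ennreal ((3 * l) ^ CARD('n))"
    using LlogL[of "3 * l" "a - (\<chi> i. l)"] l unfolding triple_def by auto
  define g where "g = (\<lambda>y. F y / ennreal \<alpha> * indicator (triple a l) y)"
  have [measurable]: "g \<in> borel_measurable lebesgue" unfolding g_def by measurable
  have F_eq: "(\<lambda>y. F y * indicator (triple a l) y) = (\<lambda>y. ennreal \<alpha> * g y)"
    unfolding g_def using ennreal_mult_divide_cancel[OF \<alpha>(1)] by (simp add: mult.assoc[symmetric])
  have "(\<integral>\<^sup>+x\<in>cube a l. maximal (\<lambda>y. F y * indicator (triple a l) y) x \<partial>lebesgue) \<le>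
      (\<integral>\<^sup>+x. ennreal \<alpha> * (maximal g x * indicator (cube a l) x) \<partial>lebesgue)"
    unfolding F_eq mult.assoc[symmetric]
    by (intro nn_integral_mono mult_right_mono maximal_cmult_le) auto
  also have "\<dots> = ennreal \<alpha> * (\<integral>\<^sup>+x\<in>cube a l. maximal g x \<partial>lebesgue)"
    by (rule nn_integral_cmult) measurable
  also have "(\<integral>\<^sup>+x\<in>cube a l. maximal g x \<partial>lebesgue) \<le> emeasure lebesgue (cube a l) +
      ennreal (4 * weak_const TYPE('n)) * (\<integral>\<^sup>+x. g x * (1 + log_plus (g x)) \<partial>lebesgue)"
    by (rule maximal_LlogL) auto
  also have "(\<integral>\<^sup>+x. g x * (1 + log_plus (g x)) \<partial>lebesgue) =
      (\<integral>\<^sup>+x\<in>triple a l. (F x / ennreal \<alpha> * (1 + log_plus (F x / ennreal \<alpha>))) \<partial>lebesgue)"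
    unfolding g_def by (intro nn_integral_cong) (auto simp: indicator_def)
  also note \<alpha>(3)
  also have "emeasure lebesgue (cube a l) + ennreal (4 * weak_const TYPE('n)) * ennreal ((3 * l) ^ CARD('n))
      = ennreal ((average_const TYPE('n) - 1) * l ^ CARD('n))"
  proof -
    have "(average_const TYPE('n) - 1) * l ^ CARD('n) = l ^ CARD('n) + 4 * weak_const TYPE('n) * (3 * l) ^ CARD('n)"
      by (simp add: average_const_def algebra_simps)
    then show ?thesis
      using l weak_const_ge_1[where 'n='n] by (subst emeasure_cube) (auto simp: ennreal_mult)
  qed
  also have "ennreal \<alpha> * ennreal ((average_const TYPE('n) - 1) * l ^ CARD('n)) \<le> ennreal (w l) * ennreal ((average_const TYPE('n) - 1) * l ^ CARD('n))"
    using \<alpha>(2) w_antimono[of l "3 * l"] l by (intro mult_right_mono ennreal_leI) auto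
  also have "\<dots> = ennreal ((average_const TYPE('n) - 1) * w l * l ^ CARD('n))"
    using l average_const_ge_1[where 'n='n] w_pos[OF l] by (subst ennreal_mult[symmetric]) (auto simp: algebra_simps)
  finally show ?thesis by (simp add: add_left_mono mult_left_mono)
qed

text \<open>The operator sends the \<open>L log L\<close> Morrey condition to the \<open>L\<^sup>1\<close> Morrey condition with the same weight: the local part
  is the previous lemma, and averages over larger cubes are at most \<open>w l\<close>.\<close>

lemma integral_maximal_le:
  assumes l: "0 < l"
  shows "(\<integral>\<^sup>+x\<in>cube a l. maximal F x \<partial>lebesgue) \<le> ennreal (average_const TYPE('n) * w l * l ^ CARD('n))"
proof -
  let ?G = "\<lambda>y. F y * indicator (triple a l) y"
  have "(\<integral>\<^sup>+x\<in>cube a l. maximal F x \<partial>lebesgue) \<le>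
      (\<integral>\<^sup>+x. maximal ?G x * indicator (cube a l) x + ennreal (w l) * indicator (cube a l) x \<partial>lebesgue)"
  proof (rule nn_integral_mono)
    fix x
    have "maximal F x \<le> maximal ?G x + ennreal (w l)" if x: "x \<in> cube a l"
    proof -
      have "maximal F x \<le> max (maximal ?G x) (ennreal (w l))"
      proof (rule maximal_localize[OF x])
        fix b m assume "l < m"
        then have "(\<integral>\<^sup>+y\<in>cube b m. F y \<partial>lebesgue) \<le> ennreal (w m * m ^ CARD('n))"
          using l by (intro integral_cube_le) simp
        also have "\<dots> \<le> ennreal (w l * m ^ CARD('n))"
          using l \<open>l < m\<close> w_antimono by (intro ennreal_leI mult_right_mono) auto
        finally show "(\<integral>\<^sup>+y\<in>cube b m. F y \<partial>lebesgue) \<le> ennreal (w l * m ^ CARD('n))" .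
      qed (use w_pos[OF l] in simp)
      also have "\<dots> \<le> maximal ?G x + ennreal (w l)" by simp
      finally show ?thesis .
    qed
    then show "maximal F x * indicator (cube a l) x \<le>
        maximal ?G x * indicator (cube a l) x + ennreal (w l) * indicator (cube a l) x"
      by (cases "x \<in> cube a l") auto
  qed
  also have "\<dots> = (\<integral>\<^sup>+x\<in>cube a l. maximal ?G x \<partial>lebesgue) + ennreal (w l) * emeasure lebesgue (cube a l)"
    by (subst nn_integral_add) (auto simp: nn_integral_cmult_indicator)
  also have "\<dots> \<le> ennreal ((average_const TYPE('n) - 1) * w l * l ^ CARD('n)) + ennreal (w l * l ^ CARD('n))"
  proof (intro add_mono integral_maximal_triple_le l)
    show "ennreal (w l) * emeasure lebesgue (cube a l) \<le> ennreal (w l * l ^ CARD('n))"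
      using l w_pos[OF l] by (subst emeasure_cube) (auto simp flip: ennreal_mult)
  qed
  also have "\<dots> = ennreal ((average_const TYPE('n) - 1) * w l * l ^ CARD('n) + w l * l ^ CARD('n))"
    using l w_pos[OF l] average_const_ge_1[where 'n='n] by (intro ennreal_plus[symmetric]) auto
  also have "(average_const TYPE('n) - 1) * w l * l ^ CARD('n) + w l * l ^ CARD('n) = average_const TYPE('n) * w l * l ^ CARD('n)"
    by (simp add: algebra_simps)
  finally show ?thesis .
qed

text \<open>For \<open>t > 1\<close> the level \<open>s = morrey_const * w l * t\<close> is at least every average of \<open>M F\<close> over the
  cubes larger than \<open>cube a l\<close>, so localization leaves the
  maximal function of \<open>M F\<close> on the triple, to which the weak type bound applies.\<close>

lemma maximal_maximal_weak:
  assumes l: "0 < l" and t: "0 < t"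
  shows "emeasure lebesgue {x \<in> cube a l. ennreal (morrey_const TYPE('n) * w l * t) < maximal (maximal F) x}
    \<le> ennreal (l ^ CARD('n) / t)"
proof (cases "t \<le> 1")
  \<comment> \<open>the right-hand side is then at least the volume of the cube\<close>
  case True
  have "emeasure lebesgue {x \<in> cube a l. ennreal (morrey_const TYPE('n) * w l * t) < maximal (maximal F) x}
      \<le> emeasure lebesgue (cube a l)"
    by (intro emeasure_mono) auto
  also have "\<dots> = ennreal (l ^ CARD('n))" using l by (simp only: emeasure_cube less_imp_le)
  also have "\<dots> \<le> ennreal (l ^ CARD('n) / t)"
    using l t True by (intro ennreal_leI) (simp add: field_simps)
  finally show ?thesis .
next
  case False
  let ?h = "\<lambda>y. maximal F y * indicator (triple a l) y"
  define s where "s = morrey_const TYPE('n) * w l * t"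
  have W: "0 < w l" using w_pos l by simp
  have "average_const TYPE('n) * w l * 1 \<le> morrey_const TYPE('n) * w l * t"
    using average_const_le_morrey_const[where 'n='n] average_const_ge_1[where 'n='n] W False by (intro mult_mono) auto
  then have s: "average_const TYPE('n) * w l \<le> s" "0 < s"
    using W average_const_ge_1[where 'n='n] by (auto simp: s_def intro: less_le_trans[of 0 "average_const TYPE('n) * w l"])
  have "{x \<in> cube a l. ennreal s < maximal (maximal F) x} \<subseteq> {x. ennreal s < maximal ?h x}"
  proof
    fix x assume "x \<in> {x \<in> cube a l. ennreal s < maximal (maximal F) x}"
    then have x: "x \<in> cube a l" "ennreal s < maximal (maximal F) x" by auto
    have "maximal (maximal F) x \<le> max (maximal ?h x) (ennreal (average_const TYPE('n) * w l))"
    proof (rule maximal_localize[OF x(1)])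
      fix b m assume "l < m"
      then have "(\<integral>\<^sup>+y\<in>cube b m. maximal F y \<partial>lebesgue) \<le> ennreal (average_const TYPE('n) * w m * m ^ CARD('n))"
        using l by (intro integral_maximal_le) simp
      also have "\<dots> \<le> ennreal (average_const TYPE('n) * w l * m ^ CARD('n))"
        using l \<open>l < m\<close> w_antimono average_const_ge_1[where 'n='n] by (intro ennreal_leI mult_right_mono mult_left_mono) auto
      finally show "(\<integral>\<^sup>+y\<in>cube b m. maximal F y \<partial>lebesgue) \<le> ennreal (average_const TYPE('n) * w l * m ^ CARD('n))" .
    qed (use W average_const_ge_1[where 'n='n] in simp)
    with x(2) have "ennreal s < max (maximal ?h x) (ennreal (average_const TYPE('n) * w l))" by (rule less_le_trans)
    moreover have "ennreal (average_const TYPE('n) * w l) \<le> ennreal s" using s by (intro ennreal_leI)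
    ultimately show "x \<in> {x. ennreal s < maximal ?h x}" by (auto simp: less_max_iff_disj)
  qed
  then have "emeasure lebesgue {x \<in> cube a l. ennreal s < maximal (maximal F) x}
      \<le> emeasure lebesgue {x. ennreal s < maximal ?h x}"
    by (intro emeasure_mono) auto
  also have "\<dots> \<le> ennreal (weak_const TYPE('n) / s) * (\<integral>\<^sup>+x. ?h x \<partial>lebesgue)"
    by (intro maximal_weak_type s) measurable
  also have "(\<integral>\<^sup>+x. ?h x \<partial>lebesgue) \<le> ennreal (average_const TYPE('n) * w (3 * l) * (3 * l) ^ CARD('n))"
    unfolding triple_def using l by (intro integral_maximal_le) simp
  also have "\<dots> \<le> ennreal (average_const TYPE('n) * w l * (3 * l) ^ CARD('n))"
    using l w_antimono[of l "3 * l"] average_const_ge_1[where 'n='n] by (intro ennreal_leI mult_right_mono mult_left_mono) auto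
  also have "ennreal (weak_const TYPE('n) / s) * ennreal (average_const TYPE('n) * w l * (3 * l) ^ CARD('n))
      = ennreal (weak_const TYPE('n) / s * (average_const TYPE('n) * w l * (3 * l) ^ CARD('n)))"
    using s W average_const_ge_1[where 'n='n] l weak_const_ge_1[where 'n='n] by (intro ennreal_mult[symmetric]) auto
  also have "weak_const TYPE('n) / s * (average_const TYPE('n) * w l * (3 * l) ^ CARD('n)) = l ^ CARD('n) / t"
    using W average_const_ge_1[where 'n='n] t weak_const_ge_1[where 'n='n] by (simp add: s_def morrey_const_def power_mult_distrib)
  finally show ?thesis by (simp add: s_def mult_left_mono)
qed

end

section \<open>From Morrey conditions to norms\<close>

text \<open>The denominator in the weak norm is at least \<open>1 / t\<close>, so a weak \<open>L\<^sup>1\<close> estimate bounds the norm.\<close>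

lemma weak_LlogL_norm_le:
  fixes a :: "real ^ 'n::finite"
  assumes l: "0 < l" and \<alpha>: "0 < \<alpha>"
    and weak: "\<And>t. 0 < t \<Longrightarrow>
      emeasure lebesgue {x \<in> cube a l. ereal (\<alpha> * t) < \<bar>g x\<bar>} \<le> ennreal (l ^ CARD('n) / t)"
  shows "weak_LlogL_norm (cube a l) g \<le> ennreal \<alpha>"
  unfolding weak_LlogL_norm_def
proof (rule Inf_lower, rule CollectI, intro exI conjI, rule refl, rule \<alpha>, rule SUP_least)
  fix t :: real assume "t \<in> {0<..}"
  then have t: "0 < t" by simp
  define V where "V = l ^ CARD('n)"
  have V: "0 < V" using l by (simp add: V_def)
  define D where "D = ennreal (1 / t) * (1 + log_plus (ennreal (1 / t)))"
  have D: "ennreal (1 / t) \<le> D"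
    unfolding D_def using mult_left_mono[of 1 "1 + log_plus (ennreal (1 / t))" "ennreal (1 / t)"] by simp
  have "0 < ennreal (1 / t)" using t by simp
  then have "0 < D" using D by (rule less_le_trans)
  have "emeasure lebesgue {x \<in> cube a l. ereal (\<alpha> * t) < \<bar>g x\<bar>} \<le> ennreal (1 / t) * ennreal V"
    using weak[OF t] t V by (simp add: V_def flip: ennreal_mult)
  also have "\<dots> \<le> D * ennreal V" using D by (rule mult_right_mono) simp
  finally have "emeasure lebesgue {x \<in> cube a l. ereal (\<alpha> * t) < \<bar>g x\<bar>} / D \<le> ennreal V"
    using \<open>0 < D\<close> by (intro divide_le_posI_ennreal)
  then have "1 / ennreal V * (emeasure lebesgue {x \<in> cube a l. ereal (\<alpha> * t) < \<bar>g x\<bar>} / D) \<le> 1 / ennreal V * ennreal V"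
    by (rule mult_left_mono) simp
  also have "\<dots> = 1" using V by (simp add: ennreal_divide_times)
  finally show "1 / emeasure lebesgue (cube a l) *
      (emeasure lebesgue {x \<in> cube a l. ereal (\<alpha> * t) < \<bar>g x\<bar>} /
        (ennreal (1 / t) * (1 + log_plus (ennreal (1 / t))))) \<le> 1"
    unfolding D_def V_def emeasure_cube[OF less_imp_le[OF l]] .
qed

text \<open>A strict upper bound for the infimum provides an admissible constant below it.\<close>

lemma LlogL_norm_less:
  fixes a :: "real ^ 'n::finite"
  assumes l: "0 < l" and less: "LlogL_norm (cube a l) f < ennreal W"
  shows "\<exists>\<alpha>. 0 < \<alpha> \<and> \<alpha> \<le> W \<and>
    (\<integral>\<^sup>+x\<in>cube a l. (e2ennreal \<bar>f x\<bar> / ennreal \<alpha> * (1 + log_plus (e2ennreal \<bar>f x\<bar> / ennreal \<alpha>))) \<partial>lebesgue)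
      \<le> ennreal (l ^ CARD('n))"
proof -
  obtain \<alpha> where \<alpha>: "0 < \<alpha>" "ennreal \<alpha> < ennreal W" and
    adm: "1 / emeasure lebesgue (cube a l) *
      (\<integral>\<^sup>+x\<in>cube a l. (e2ennreal \<bar>f x\<bar> / ennreal \<alpha> * (1 + log_plus (e2ennreal \<bar>f x\<bar> / ennreal \<alpha>))) \<partial>lebesgue) \<le> 1"
    (is "_ * ?I \<le> 1")
    using less unfolding LlogL_norm_def Inf_less_iff by blast
  have "\<not> ennreal 1 < 1 / emeasure lebesgue (cube a l) * ?I" using adm by simp
  then have "?I \<le> ennreal (l ^ CARD('n))"
    by (subst (asm) average_gt_iff[OF l]) (auto simp: not_less)
  moreover have "\<alpha> \<le> W" using \<alpha> by (simp add: ennreal_less_iff)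
  ultimately show ?thesis using \<alpha> by blast
qed

lemma less_abs_enn2ereal_iff:
  assumes "0 \<le> r"
  shows "ereal r < \<bar>enn2ereal v\<bar> \<longleftrightarrow> ennreal r < v"
  using assms by (simp add: less_ennreal.rep_eq enn2ereal_ennreal)

lemma LlogL_norm_less_of_zygmund_morrey_norm:
  fixes a :: "real ^ 'n::finite"
  assumes l: "0 < l" and less: "zygmund_morrey_norm lam f < ennreal \<nu>"
  shows "LlogL_norm (cube a l) f < ennreal (\<nu> * (l ^ CARD('n)) powr - (lam / real CARD('n)))"
proof (rule ccontr)
  define q where "q = (l ^ CARD('n)) powr (lam / real CARD('n))"
  have q: "0 < q" using l by (simp add: q_def)
  assume "\<not> ?thesis"
  then have "ennreal q * ennreal (\<nu> * (l ^ CARD('n)) powr - (lam / real CARD('n))) \<le> ennreal q * LlogL_norm (cube a l) f"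
    by (intro mult_left_mono) auto
  also have "ennreal q * ennreal (\<nu> * (l ^ CARD('n)) powr - (lam / real CARD('n))) = ennreal \<nu>"
  proof -
    have "q * (\<nu> * (l ^ CARD('n)) powr - (lam / real CARD('n))) = \<nu>"
      using q unfolding powr_minus q_def[symmetric] by (simp add: field_simps)
    moreover have "ennreal q * ennreal (\<nu> * (l ^ CARD('n)) powr - (lam / real CARD('n))) =
        ennreal (q * (\<nu> * (l ^ CARD('n)) powr - (lam / real CARD('n))))"
      using q by (intro ennreal_mult'[symmetric]) simp
    ultimately show ?thesis by (simp only:)
  qed
  also have "ennreal q * LlogL_norm (cube a l) f \<le> zygmund_morrey_norm lam f"
    unfolding zygmund_morrey_norm_def
  proof (rule SUP_upper2)
    show "cube a l \<in> cubes" using l by (auto simp: cubes_iff)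
    show "ennreal q * LlogL_norm (cube a l) f \<le>
        ennreal (measure lebesgue (cube a l) powr (lam / real CARD('n))) * LlogL_norm (cube a l) f"
      unfolding q_def measure_cube[OF less_imp_le[OF l]] ..
  qed
  finally show False using less by simp
qed

text \<open>The weight is \<open>\<nu>\<close> times the volume to the power \<open>- lam / n\<close>. It is positive, since \<open>\<nu>\<close> exceeds a norm, even when
  that norm vanishes.\<close>

lemma weak_zygmund_morrey_norm_maximal_maximal_le:
  fixes f :: "real ^ 'n::finite \<Rightarrow> ereal"
  assumes lam: "0 \<le> lam" and f: "f \<in> borel_measurable lebesgue"
    and less: "zygmund_morrey_norm lam f < ennreal \<nu>"
  shows "weak_zygmund_morrey_norm lam (hl_maximal (hl_maximal f)) \<le> ennreal (morrey_const TYPE('n) * \<nu>)"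
proof -
  note [measurable] = f
  define F where "F = (\<lambda>y. e2ennreal \<bar>f y\<bar>)"
  define p where "p = lam / real CARD('n)"
  define w where "w l = \<nu> * (l ^ CARD('n)) powr - p" for l
  have \<nu>: "0 < \<nu>" using less by (metis ennreal_less_zero_iff le_less_trans zero_le)
  have K: "0 < morrey_const TYPE('n)"
    using average_const_ge_1[where 'n='n] average_const_le_morrey_const[where 'n='n] by linarith
  interpret LlogL_Morrey F w
  proof
    show "F \<in> borel_measurable lebesgue" unfolding F_def by measurable
  next
    fix l :: real assume "0 < l"
    then show "0 < w l" using \<nu> by (simp add: w_def)
  next
    fix l m :: real assume "0 < l" "l \<le> m"
    then have "l ^ CARD('n) \<le> m ^ CARD('n)" "0 < l ^ CARD('n)" by (auto intro: power_mono)
    then show "w m \<le> w l"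
      unfolding w_def using \<nu> lam by (intro mult_left_mono powr_mono2') (auto simp: p_def)
  next
    fix l :: real and a :: "real ^ 'n"
    assume l: "0 < l"
    show "\<exists>\<alpha>. 0 < \<alpha> \<and> \<alpha> \<le> w l \<and>
      (\<integral>\<^sup>+x\<in>cube a l. (F x / ennreal \<alpha> * (1 + log_plus (F x / ennreal \<alpha>))) \<partial>lebesgue) \<le> ennreal (l ^ CARD('n))"
      unfolding F_def w_def p_def
      by (rule LlogL_norm_less[OF l LlogL_norm_less_of_zygmund_morrey_norm[OF l less]])
  qed
  show ?thesis
    unfolding weak_zygmund_morrey_norm_def
  proof (rule SUP_least)
    fix Q :: "(real ^ 'n) set" assume "Q \<in> cubes"
    then obtain a l where Q: "Q = cube a l" and l: "0 < l" by (auto simp: cubes_iff)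
    have W: "0 < w l" using w_pos l by simp
    have eq: "hl_maximal (hl_maximal f) x = enn2ereal (maximal (maximal F) x)" for x
      unfolding hl_maximal_eq_maximal[of "hl_maximal f"] e2ennreal_abs_hl_maximal F_def ..
    have "weak_LlogL_norm (cube a l) (hl_maximal (hl_maximal f)) \<le> ennreal (morrey_const TYPE('n) * w l)"
    proof (rule weak_LlogL_norm_le[OF l])
      show "0 < morrey_const TYPE('n) * w l" using K W by simp
      fix t :: real assume t: "0 < t"
      then have "0 \<le> morrey_const TYPE('n) * w l * t" using K W by simp
      then show "emeasure lebesgue {x \<in> cube a l. ereal (morrey_const TYPE('n) * w l * t) < \<bar>hl_maximal (hl_maximal f) x\<bar>}
          \<le> ennreal (l ^ CARD('n) / t)"
        unfolding eq less_abs_enn2ereal_iff[OF \<open>0 \<le> morrey_const TYPE('n) * w l * t\<close>]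
        by (intro maximal_maximal_weak l t)
    qed
    then have "ennreal ((l ^ CARD('n)) powr p) * weak_LlogL_norm (cube a l) (hl_maximal (hl_maximal f))
        \<le> ennreal ((l ^ CARD('n)) powr p) * ennreal (morrey_const TYPE('n) * w l)"
      by (rule mult_left_mono) simp
    also have "\<dots> = ennreal (morrey_const TYPE('n) * \<nu>)"
    proof -
      have "(l ^ CARD('n)) powr p * (morrey_const TYPE('n) * w l) = morrey_const TYPE('n) * \<nu>"
        using l by (simp add: w_def powr_minus field_simps)
      moreover have "ennreal ((l ^ CARD('n)) powr p) * ennreal (morrey_const TYPE('n) * w l) =
          ennreal ((l ^ CARD('n)) powr p * (morrey_const TYPE('n) * w l))"
        by (intro ennreal_mult'[symmetric]) simp
      ultimately show ?thesis by (simp only:)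
    qed
    finally show "ennreal (measure lebesgue Q powr (lam / real CARD('n))) *
        weak_LlogL_norm Q (hl_maximal (hl_maximal f)) \<le> ennreal (morrey_const TYPE('n) * \<nu>)"
      unfolding Q measure_cube[OF less_imp_le[OF l]] p_def .
  qed
qed

theorem theorem6p1:
  fixes lam :: real
  assumes "0 < lam" and "lam < real CARD('n::finite)"
  shows "\<exists>c::real. 0 < c \<and>
    (\<forall>f :: real ^ 'n \<Rightarrow> ereal. f \<in> zygmund_morrey lam \<longrightarrow>
      hl_maximal (hl_maximal f) \<in> weak_zygmund_morrey lam \<and>
      weak_zygmund_morrey_norm lam (hl_maximal (hl_maximal f))
        \<le> ennreal c * zygmund_morrey_norm lam f)"
proof (intro exI conjI allI impI)
  let ?c = "morrey_const TYPE('n)"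
  show c: "0 < ?c"
    using average_const_ge_1[where 'n='n] average_const_le_morrey_const[where 'n='n] by linarith
  fix f :: "real ^ 'n \<Rightarrow> ereal"
  assume "f \<in> zygmund_morrey lam"
  then have f: "f \<in> borel_measurable lebesgue" and fin: "zygmund_morrey_norm lam f < \<infinity>"
    by (auto simp: zygmund_morrey_def)
  from fin obtain N where N: "zygmund_morrey_norm lam f = ennreal N" "0 \<le> N"
    by (cases "zygmund_morrey_norm lam f") auto
  show bound: "weak_zygmund_morrey_norm lam (hl_maximal (hl_maximal f)) \<le> ennreal ?c * zygmund_morrey_norm lam f"
  proof (rule ennreal_le_epsilon)
    fix e :: real assume e: "0 < e"
    have "weak_zygmund_morrey_norm lam (hl_maximal (hl_maximal f)) \<le> ennreal (?c * (N + e / ?c))"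
    proof (rule weak_zygmund_morrey_norm_maximal_maximal_le[OF _ f])
      show "zygmund_morrey_norm lam f < ennreal (N + e / ?c)"
        using N c e by (simp add: ennreal_less_iff del: ennreal_plus)
    qed (use assms in simp)
    also have "?c * (N + e / ?c) = ?c * N + e" using c by (simp add: field_simps)
    also have "ennreal (?c * N + e) = ennreal ?c * zygmund_morrey_norm lam f + ennreal e"
      using c N e by (simp add: ennreal_mult)
    finally show "weak_zygmund_morrey_norm lam (hl_maximal (hl_maximal f)) \<le> \<dots>" .
  qed
  have "hl_maximal (hl_maximal f) \<in> borel_measurable lebesgue"
    unfolding hl_maximal_eq_maximal[of "hl_maximal f", abs_def] by measurable
  moreover have "ennreal ?c * zygmund_morrey_norm lam f < \<infinity>"
    using N by (simp add: ennreal_mult_less_top)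
  ultimately show "hl_maximal (hl_maximal f) \<in> weak_zygmund_morrey lam"
    using bound by (auto simp: weak_zygmund_morrey_def)
qed

end
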